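(* Let $E$ be a locally convex vector space. (a) Let $A\subseteq\mathcal G_E$ be internal and let $S\subset(0,1)$. Then for all $u,v\in A$, $e_Su+e_{S^c}v\in A$. (b) For an arbitrary subset $A\subseteq\mathcal G_E$, let $$\mathrm{interl}(A)=\Big\{\sum_{j=1}^m e_{S_j}a_j: m\in\mathbb N,\ \{S_1,\dots,S_m\}\text{ a partition of }(0,1),\ a_j\in A\Big\}.$$ Then $A\subseteq\mathrm{interl}(A)$. If $A$ is internal, then $\mathrm{interl}(A)=A$.
   Context: For a locally convex space $E$ with topology generated by seminorms $(p_i)_{i\in I}$: a net $(u_\varepsilon)_\varepsilon\in E^{(0,1)}$ is moderate if for each $i\in I$ there are $M\in\mathbb N$ and $\eta\in(0,1)$ with $p_i(u_\varepsilon)\le\varepsilon^{-M}$ for all $\varepsilon\le\eta$; it is negligible if for each $i\in I$ and each $m\in\mathbb N$ there is $\eta\in(0,1)$ with $p_i(u_\varepsilon)\le\varepsilon^m$ for all $\varepsilon\le\eta$. The Colombeau space based on $E$ is the quotient $\mathcal G_E$ of the moderate nets by the negligible nets; a net in the class $u\in\mathcal G_E$ is called a representative of $u$. $\widetilde{\mathbb R}=\mathcal G_{\mathbb R}$ is the ring of generalized real numbers, and $\mathcal G_E$ is an $\widetilde{\mathbb R}$-module through $\varepsilon$-wise operations on representatives. For $S\subseteq(0,1)$, $e_S\in\widetilde{\mathbb R}$ is the generalized number with representative $(\chi_S(\varepsilon))_\varepsilon$, where $\chi_S$ is the characteristic function of $S$, and $S^c=(0,1)\setminus S$. A subset $A\subseteq\mathcal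 G_E$ is internal if there is a net $(A_\varepsilon)_{\varepsilon\in(0,1)}$ of subsets of $E$ such that $A=[(A_\varepsilon)_\varepsilon]$, the set of all $u\in\mathcal G_E$ for which there exist a representative $(u_\varepsilon)_\varepsilon$ of $u$ and $\eta>0$ such that $u_\varepsilon\in A_\varepsilon$ for all $\varepsilon<\eta$. *)

theory Defs
  imports
    "HOL-Analysis.Abstract_Topology"
    "HOL-Library.Indicator_Function"
    "HOL-Library.Disjoint_Sets"
    "HOL-Algebra.Module"
begin

section \<open>Locally convex spaces\<close>

definition seminorm :: "('a::real_vector \<Rightarrow> real) \<Rightarrow> bool" where
  "seminorm q \<longleftrightarrow>
     (\<forall>x. 0 \<le> q x) \<and> (\<forall>x y. q (x + y) \<le> q x + q y) \<and> (\<forall>c x. q (c *\<^sub>R x) = \<bar>c\<bar> * q x)"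

text \<open>
  The space is the whole type \<open>'a\<close>, and \<open>T\<close> is the topology generated by the seminorms
  \<open>p i\<close> for \<open>i \<in> I\<close>: the finite intersections of open semiballs around a point form a
  neighbourhood base there. Hausdorffness is not required. Complex spaces are covered by
  restriction of scalars, since the seminorms and the \<open>\<epsilon>\<close>-wise operations below only
  involve the real structure.
\<close>

definition locally_convex_space ::
    "'a::real_vector topology \<Rightarrow> 'i set \<Rightarrow> ('i \<Rightarrow> 'a \<Rightarrow> real) \<Rightarrow> bool" where
  "locally_convex_space T I p \<longleftrightarrow>
     (\<forall>i\<in>I. seminorm (p i)) \<and>
     (\<forall>U. openin T U \<longleftrightarrow>
        (\<forall>x\<in>U. \<exists>J r. finite J \<and> J \<subseteq> I \<and> r > 0 \<and> {y. \<forall>i\<in>J. p i (y - x) < r} \<subseteq> U))"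


section \<open>The Colombeau space based on a family of seminorms\<close>

text \<open>
  A net indexed by the open unit interval is represented by a function on all of \<open>real\<close>.
  No definition below looks at its values outside that interval, so two functions that agree
  on it are in the same class.
\<close>

definition moderate :: "'i set \<Rightarrow> ('i \<Rightarrow> 'a::real_vector \<Rightarrow> real) \<Rightarrow> (real \<Rightarrow> 'a) set" where
  "moderate I p =
     {u. \<forall>i\<in>I. \<exists>M::nat. \<exists>\<eta>\<in>{0<..<1}. \<forall>\<epsilon>\<in>{0<..<1}. \<epsilon> \<le> \<eta> \<longrightarrow> p i (u \<epsilon>) \<le> 1 / \<epsilon> ^ M}"

definition negligible :: "'i set \<Rightarrow> ('i \<Rightarrow> 'a::real_vector \<Rightarrow> real) \<Rightarrow> (real \<Rightarrow> 'a) set" where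
  "negligible I p =
     {u. \<forall>i\<in>I. \<forall>m::nat. \<exists>\<eta>\<in>{0<..<1}. \<forall>\<epsilon>\<in>{0<..<1}. \<epsilon> \<le> \<eta> \<longrightarrow> p i (u \<epsilon>) \<le> \<epsilon> ^ m}"

definition colombeau_rel ::
    "'i set \<Rightarrow> ('i \<Rightarrow> 'a::real_vector \<Rightarrow> real) \<Rightarrow> ((real \<Rightarrow> 'a) \<times> (real \<Rightarrow> 'a)) set" where
  "colombeau_rel I p =
     {(u, v). u \<in> moderate I p \<and> v \<in> moderate I p \<and> (\<lambda>\<epsilon>. u \<epsilon> - v \<epsilon>) \<in> negligible I p}"

definition colombeau_class ::
    "'i set \<Rightarrow> ('i \<Rightarrow> 'a::real_vector \<Rightarrow> real) \<Rightarrow> (real \<Rightarrow> 'a) \<Rightarrow> (real \<Rightarrow> 'a) set" where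
  "colombeau_class I p u = colombeau_rel I p `` {u}"

definition colombeau_carrier ::
    "'i set \<Rightarrow> ('i \<Rightarrow> 'a::real_vector \<Rightarrow> real) \<Rightarrow> (real \<Rightarrow> 'a) set set" where
  "colombeau_carrier I p = moderate I p // colombeau_rel I p"

definition colombeau_add ::
    "'i set \<Rightarrow> ('i \<Rightarrow> 'a::real_vector \<Rightarrow> real) \<Rightarrow>
     (real \<Rightarrow> 'a) set \<Rightarrow> (real \<Rightarrow> 'a) set \<Rightarrow> (real \<Rightarrow> 'a) set" where
  "colombeau_add I p X Y = (\<Union>u\<in>X. \<Union>v\<in>Y. colombeau_class I p (\<lambda>\<epsilon>. u \<epsilon> + v \<epsilon>))"

definition colombeau_scale ::
    "'i set \<Rightarrow> ('i \<Rightarrow> 'a::real_vector \<Rightarrow> real) \<Rightarrow>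
     (real \<Rightarrow> real) set \<Rightarrow> (real \<Rightarrow> 'a) set \<Rightarrow> (real \<Rightarrow> 'a) set" where
  "colombeau_scale I p C X = (\<Union>c\<in>C. \<Union>u\<in>X. colombeau_class I p (\<lambda>\<epsilon>. c \<epsilon> *\<^sub>R u \<epsilon>))"

text \<open>The generalized real numbers, i.e. the space based on the real line with its absolute value.\<close>

abbreviation real_seminorms :: "unit \<Rightarrow> real \<Rightarrow> real" where
  "real_seminorms \<equiv> \<lambda>_. abs"

definition gen_real :: "(real \<Rightarrow> real) set ring" where
  "gen_real =
     \<lparr> carrier = colombeau_carrier UNIV real_seminorms,
       mult = (\<lambda>C D. \<Union>c\<in>C. \<Union>d\<in>D. colombeau_class UNIV real_seminorms (\<lambda>\<epsilon>. c \<epsilon> * d \<epsilon>)),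
       one = colombeau_class UNIV real_seminorms (\<lambda>_. 1),
       zero = colombeau_class UNIV real_seminorms (\<lambda>_. 0),
       add = colombeau_add UNIV real_seminorms \<rparr>"

text \<open>
  The record type for modules extends the one for rings; its fields \<open>mult\<close> and \<open>one\<close>
  have no meaning for a module and are left unspecified.
\<close>

definition colombeau ::
    "'i set \<Rightarrow> ('i \<Rightarrow> 'a::real_vector \<Rightarrow> real) \<Rightarrow> ((real \<Rightarrow> real) set, (real \<Rightarrow> 'a) set) module" where
  "colombeau I p =
     \<lparr> carrier = colombeau_carrier I p,
       mult = undefined,
       one = undefined,
       zero = colombeau_class I p (\<lambda>_. 0),
       add = colombeau_add I p,
       smult = colombeau_scale I p \<rparr>"

definition gen_indicator :: "real set \<Rightarrow> (real \<Rightarrow> real) set" where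
  "gen_indicator S = colombeau_class UNIV real_seminorms (indicator S)"


section \<open>Internal sets and interleaving\<close>

text \<open>The representatives of a generalized point are exactly its elements.\<close>

definition internal_set ::
    "'i set \<Rightarrow> ('i \<Rightarrow> 'a::real_vector \<Rightarrow> real) \<Rightarrow> (real \<Rightarrow> 'a set) \<Rightarrow> (real \<Rightarrow> 'a) set set" where
  "internal_set I p A =
     {U \<in> carrier (colombeau I p). \<exists>u\<in>U. \<exists>\<eta>>0. \<forall>\<epsilon>\<in>{0<..<1}. \<epsilon> < \<eta> \<longrightarrow> u \<epsilon> \<in> A \<epsilon>}"

definition internal ::
    "'i set \<Rightarrow> ('i \<Rightarrow> 'a::real_vector \<Rightarrow> real) \<Rightarrow> (real \<Rightarrow> 'a) set set \<Rightarrow> bool" where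
  "internal I p B \<longleftrightarrow> (\<exists>A. B = internal_set I p A)"

text \<open>
  Injectivity of \<open>S\<close> makes \<open>S 1, \<dots>, S m\<close> a list of the \<open>m\<close> different blocks of the
  partition. The case \<open>m = 0\<close> cannot occur, as the unit interval is not empty.
\<close>

definition interl ::
    "'i set \<Rightarrow> ('i \<Rightarrow> 'a::real_vector \<Rightarrow> real) \<Rightarrow> (real \<Rightarrow> 'a) set set \<Rightarrow> (real \<Rightarrow> 'a) set set" where
  "interl I p A =
     {\<Oplus>\<^bsub>colombeau I p\<^esub>j\<in>{1..m}. gen_indicator (S j) \<odot>\<^bsub>colombeau I p\<^esub> a j | m S a.
        partition_on {0<..<1} (S ` {1..m::nat}) \<and> inj_on S {1..m} \<and> (\<forall>j\<in>{1..m}. a j \<in> A)}"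


section \<open>Well-definedness of the operations\<close>

lemma eventually_unit_interval:
  "(\<exists>\<eta>\<in>{0<..<1}. \<forall>\<epsilon>\<in>{0<..<1}. \<epsilon> \<le> \<eta> \<longrightarrow> P \<epsilon>) \<longleftrightarrow> (\<forall>\<^sub>F \<epsilon> in at_right (0::real). P \<epsilon>)"
proof
  assume "\<exists>\<eta>\<in>{0<..<1}. \<forall>\<epsilon>\<in>{0<..<1}. \<epsilon> \<le> \<eta> \<longrightarrow> P \<epsilon>"
  then obtain \<eta> where "\<eta> \<in> {0<..<1}" "\<forall>\<epsilon>\<in>{0<..<1}. \<epsilon> \<le> \<eta> \<longrightarrow> P \<epsilon>" by blast
  then show "\<forall>\<^sub>F \<epsilon> in at_right 0. P \<epsilon>"
    by (auto simp: eventually_at_right_field intro!: exI[of _ \<eta>])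
next
  assume "\<forall>\<^sub>F \<epsilon> in at_right 0. P \<epsilon>"
  then obtain b where b: "b > 0" "\<And>y. 0 < y \<Longrightarrow> y < b \<Longrightarrow> P y"
    by (auto simp: eventually_at_right_field)
  show "\<exists>\<eta>\<in>{0<..<1}. \<forall>\<epsilon>\<in>{0<..<1}. \<epsilon> \<le> \<eta> \<longrightarrow> P \<epsilon>"
    by (rule bexI[of _ "min b 1 / 2"]) (use b in \<open>auto simp: min_def split: if_splits\<close>)
qed

lemma moderate_iff:
  "u \<in> moderate I p \<longleftrightarrow> (\<forall>i\<in>I. \<exists>M::nat. \<forall>\<^sub>F \<epsilon> in at_right 0. p i (u \<epsilon>) \<le> 1 / \<epsilon> ^ M)"
  by (simp add: moderate_def eventually_unit_interval)

lemma negligible_iff: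
  "u \<in> negligible I p \<longleftrightarrow> (\<forall>i\<in>I. \<forall>m::nat. \<forall>\<^sub>F \<epsilon> in at_right 0. p i (u \<epsilon>) \<le> \<epsilon> ^ m)"
  by (simp add: negligible_def eventually_unit_interval)

lemma eventually_small: "\<forall>\<^sub>F \<epsilon> in at_right (0::real). 0 < \<epsilon> \<and> \<epsilon> < 1 / 2"
  by (auto simp: eventually_at_right_field intro!: exI[of _ "1/2"])

lemma seminorm_zero: "seminorm q \<Longrightarrow> q 0 = 0"
  unfolding seminorm_def by (metis abs_zero mult_zero_left scaleR_zero_left)

lemma seminorm_real: "seminorm (abs :: real \<Rightarrow> real)"
  by (simp add: seminorm_def abs_mult abs_triangle_ineq)

lemma double_bound_neg:
  fixes \<epsilon> :: real
  assumes "0 < \<epsilon>" "\<epsilon> < 1 / 2"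
  shows "\<epsilon> ^ Suc m + \<epsilon> ^ Suc m \<le> \<epsilon> ^ m"
  using assms mult_right_mono[of "2 * \<epsilon>" 1 "\<epsilon> ^ m"] by simp

lemma double_bound_mod:
  fixes \<epsilon> :: real
  assumes "0 < \<epsilon>" "\<epsilon> < 1 / 2"
  shows "1 / \<epsilon> ^ M + 1 / \<epsilon> ^ N \<le> 1 / \<epsilon> ^ Suc (M + N)"
proof -
  have *: "1 / \<epsilon> ^ M \<le> 1 / \<epsilon> ^ (M + N)" "1 / \<epsilon> ^ N \<le> 1 / \<epsilon> ^ (M + N)"
    using assms by (auto intro!: divide_left_mono power_decreasing)
  have "2 * (1 / \<epsilon> ^ (M + N)) \<le> (1 / \<epsilon>) * (1 / \<epsilon> ^ (M + N))"
    using assms by (intro mult_right_mono) (auto simp: field_simps)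
  with * show ?thesis by simp
qed

context
  fixes I :: "'i set" and p :: "'i \<Rightarrow> 'a::real_vector \<Rightarrow> real"
  assumes sn: "\<And>i. i \<in> I \<Longrightarrow> seminorm (p i)"
begin

lemma moderate_add:
  assumes "u \<in> moderate I p" "v \<in> moderate I p"
  shows "(\<lambda>\<epsilon>. u \<epsilon> + v \<epsilon>) \<in> moderate I p"
  unfolding moderate_iff
proof
  fix i assume i: "i \<in> I"
  obtain M N where "\<forall>\<^sub>F \<epsilon> in at_right 0. p i (u \<epsilon>) \<le> 1 / \<epsilon> ^ M" "\<forall>\<^sub>F \<epsilon> in at_right 0. p i (v \<epsilon>) \<le> 1 / \<epsilon> ^ N"
    using assms i unfolding moderate_iff by blast
  then have "\<forall>\<^sub>F \<epsilon> in at_right 0. p i (u \<epsilon> + v \<epsilon>) \<le> 1 / \<epsilon> ^ Suc (M + N)"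
    using eventually_small
  proof eventually_elim
    case (elim \<epsilon>)
    have "p i (u \<epsilon> + v \<epsilon>) \<le> p i (u \<epsilon>) + p i (v \<epsilon>)"
      using sn[OF i] by (simp add: seminorm_def)
    then show ?case using elim double_bound_mod[of \<epsilon> M N] by linarith
  qed
  then show "\<exists>M. \<forall>\<^sub>F \<epsilon> in at_right 0. p i (u \<epsilon> + v \<epsilon>) \<le> 1 / \<epsilon> ^ M" by blast
qed

lemma negligible_add:
  assumes "u \<in> negligible I p" "v \<in> negligible I p"
  shows "(\<lambda>\<epsilon>. u \<epsilon> + v \<epsilon>) \<in> negligible I p"
  unfolding negligible_iff
proof (intro ballI allI)
  fix i and m :: nat assume i: "i \<in> I"
  have "\<forall>\<^sub>F \<epsilon> in at_right 0. p i (u \<epsilon>) \<le> \<epsilon> ^ Suc m" "\<forall>\<^sub>F \<epsilon> in at_right 0. p i (v \<epsilon>) \<le> \<epsilon> ^ Suc m"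
    using assms i unfolding negligible_iff by blast+
  then show "\<forall>\<^sub>F \<epsilon> in at_right 0. p i (u \<epsilon> + v \<epsilon>) \<le> \<epsilon> ^ m"
    using eventually_small
  proof eventually_elim
    case (elim \<epsilon>)
    have "p i (u \<epsilon> + v \<epsilon>) \<le> p i (u \<epsilon>) + p i (v \<epsilon>)"
      using sn[OF i] by (simp add: seminorm_def)
    then show ?case using elim double_bound_neg[of \<epsilon> m] by linarith
  qed
qed

lemma moderate_scale:
  assumes "c \<in> moderate UNIV real_seminorms" "u \<in> moderate I p"
  shows "(\<lambda>\<epsilon>. c \<epsilon> *\<^sub>R u \<epsilon>) \<in> moderate I p"
  unfolding moderate_iff
proof
  fix i assume i: "i \<in> I"
  obtain M N where "\<forall>\<^sub>F \<epsilon> in at_right 0. \<bar>c \<epsilon>\<bar> \<le> 1 / \<epsilon> ^ M" "\<forall>\<^sub>F \<epsilon> in at_right 0. p i (u \<epsilon>) \<le> 1 / \<epsilon> ^ N"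
    using assms i unfolding moderate_iff by blast
  then have "\<forall>\<^sub>F \<epsilon> in at_right 0. p i (c \<epsilon> *\<^sub>R u \<epsilon>) \<le> 1 / \<epsilon> ^ (M + N)"
    using eventually_small
  proof eventually_elim
    case (elim \<epsilon>)
    then have "\<bar>c \<epsilon>\<bar> * p i (u \<epsilon>) \<le> (1 / \<epsilon> ^ M) * (1 / \<epsilon> ^ N)"
      using sn[OF i] by (intro mult_mono) (auto simp: seminorm_def)
    then show ?case using sn[OF i] by (simp add: seminorm_def power_add)
  qed
  then show "\<exists>M. \<forall>\<^sub>F \<epsilon> in at_right 0. p i (c \<epsilon> *\<^sub>R u \<epsilon>) \<le> 1 / \<epsilon> ^ M" by blast
qed

lemma negligible_scale_left:
  assumes "c \<in> negligible UNIV real_seminorms" "u \<in> moderate I p"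
  shows "(\<lambda>\<epsilon>. c \<epsilon> *\<^sub>R u \<epsilon>) \<in> negligible I p"
  unfolding negligible_iff
proof (intro ballI allI)
  fix i and m :: nat assume i: "i \<in> I"
  obtain N where "\<forall>\<^sub>F \<epsilon> in at_right 0. p i (u \<epsilon>) \<le> 1 / \<epsilon> ^ N"
    using assms i unfolding moderate_iff by blast
  moreover have "\<forall>\<^sub>F \<epsilon> in at_right 0. \<bar>c \<epsilon>\<bar> \<le> \<epsilon> ^ (m + N)"
    using assms unfolding negligible_iff by blast
  ultimately show "\<forall>\<^sub>F \<epsilon> in at_right 0. p i (c \<epsilon> *\<^sub>R u \<epsilon>) \<le> \<epsilon> ^ m"
    using eventually_small
  proof eventually_elim
    case (elim \<epsilon>)
    then have "\<bar>c \<epsilon>\<bar> * p i (u \<epsilon>) \<le> \<epsilon> ^ (m + N) * (1 / \<epsilon> ^ N)"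
      using sn[OF i] by (intro mult_mono) (auto simp: seminorm_def)
    then show ?case using sn[OF i] elim by (simp add: seminorm_def power_add)
  qed
qed

lemma negligible_scale_right:
  assumes "c \<in> moderate UNIV real_seminorms" "u \<in> negligible I p"
  shows "(\<lambda>\<epsilon>. c \<epsilon> *\<^sub>R u \<epsilon>) \<in> negligible I p"
  unfolding negligible_iff
proof (intro ballI allI)
  fix i and m :: nat assume i: "i \<in> I"
  obtain N where "\<forall>\<^sub>F \<epsilon> in at_right 0. \<bar>c \<epsilon>\<bar> \<le> 1 / \<epsilon> ^ N"
    using assms i unfolding moderate_iff by blast
  moreover have "\<forall>\<^sub>F \<epsilon> in at_right 0. p i (u \<epsilon>) \<le> \<epsilon> ^ (m + N)"
    using assms i unfolding negligible_iff by blast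
  ultimately show "\<forall>\<^sub>F \<epsilon> in at_right 0. p i (c \<epsilon> *\<^sub>R u \<epsilon>) \<le> \<epsilon> ^ m"
    using eventually_small
  proof eventually_elim
    case (elim \<epsilon>)
    then have "\<bar>c \<epsilon>\<bar> * p i (u \<epsilon>) \<le> (1 / \<epsilon> ^ N) * \<epsilon> ^ (m + N)"
      using sn[OF i] by (intro mult_mono) (auto simp: seminorm_def)
    then show ?case using sn[OF i] elim by (simp add: seminorm_def power_add)
  qed
qed

end

lemma moderate_real_const: "(\<lambda>_. k) \<in> moderate UNIV real_seminorms"
proof -
  obtain n where n: "\<bar>k\<bar> < 2 ^ n" using real_arch_pow[of 2 "\<bar>k\<bar>"] by auto
  have "\<forall>\<^sub>F \<epsilon> in at_right 0. \<bar>k\<bar> \<le> 1 / \<epsilon> ^ n"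
    using eventually_small
  proof eventually_elim
    case (elim \<epsilon>)
    then have "2 ^ n \<le> (1 / \<epsilon>) ^ n" by (intro power_mono) (auto simp: field_simps)
    then show ?case using n by (simp add: power_one_over)
  qed
  then show ?thesis unfolding moderate_iff by blast
qed

lemma moderate_indicator: "indicator S \<in> moderate UNIV real_seminorms"
  unfolding moderate_iff by (auto intro!: exI[of _ 0] always_eventually simp: indicator_def)

context
  fixes I :: "'i set" and p :: "'i \<Rightarrow> 'a::real_vector \<Rightarrow> real"
  assumes sn: "\<And>i. i \<in> I \<Longrightarrow> seminorm (p i)"
begin

lemma negligible_zero: "(\<lambda>_. 0) \<in> negligible I p"
  unfolding negligible_iff
proof (intro ballI allI)
  fix i and m :: nat assume "i \<in> I"
  then show "\<forall>\<^sub>F \<epsilon> in at_right 0. p i 0 \<le> \<epsilon> ^ m"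
    using seminorm_zero[OF sn] eventually_small by (auto elim: eventually_mono)
qed

lemma moderate_zero: "(\<lambda>_. 0) \<in> moderate I p"
  unfolding moderate_iff
proof
  fix i assume "i \<in> I"
  then show "\<exists>M. \<forall>\<^sub>F \<epsilon> in at_right 0. p i 0 \<le> 1 / \<epsilon> ^ M"
    using seminorm_zero[OF sn] by (auto intro!: exI[of _ 0])
qed

lemma moderate_minus: "u \<in> moderate I p \<Longrightarrow> (\<lambda>\<epsilon>. - u \<epsilon>) \<in> moderate I p"
  using moderate_scale[of I p "\<lambda>_. -1" u] sn moderate_real_const[of "-1"] by simp

lemma negligible_minus: "u \<in> negligible I p \<Longrightarrow> (\<lambda>\<epsilon>. - u \<epsilon>) \<in> negligible I p"
  using negligible_scale_right[of I p "\<lambda>_. -1" u] sn moderate_real_const[of "-1"] by simp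

lemma equiv_colombeau_rel: "equiv (moderate I p) (colombeau_rel I p)"
proof (rule equivI)
  show "colombeau_rel I p \<subseteq> moderate I p \<times> moderate I p"
    by (auto simp: colombeau_rel_def)
  show "refl_on (moderate I p) (colombeau_rel I p)"
    using negligible_zero by (auto simp: refl_on_def colombeau_rel_def)
  show "sym (colombeau_rel I p)"
    using negligible_minus by (fastforce simp: sym_def colombeau_rel_def)
  show "trans (colombeau_rel I p)"
  proof (rule transI)
    fix u v w assume "(u, v) \<in> colombeau_rel I p" "(v, w) \<in> colombeau_rel I p"
    then show "(u, w) \<in> colombeau_rel I p"
      using negligible_add[of I p "\<lambda>\<epsilon>. u \<epsilon> - v \<epsilon>" "\<lambda>\<epsilon>. v \<epsilon> - w \<epsilon>"] sn
      by (auto simp: colombeau_rel_def)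
  qed
qed

lemma colombeau_class_in_carrier:
  "u \<in> moderate I p \<Longrightarrow> colombeau_class I p u \<in> colombeau_carrier I p"
  by (simp add: colombeau_class_def colombeau_carrier_def quotientI)

lemma colombeau_carrier_cases:
  assumes "X \<in> colombeau_carrier I p"
  obtains u where "u \<in> moderate I p" "X = colombeau_class I p u"
  using assms unfolding colombeau_carrier_def colombeau_class_def by (rule quotientE)

lemma colombeau_carrier_ex:
  "X \<in> colombeau_carrier I p \<Longrightarrow> \<exists>u. u \<in> moderate I p \<and> X = colombeau_class I p u"
  by (auto elim: colombeau_carrier_cases)

lemma colombeau_class_eq:
  assumes "u \<in> moderate I p" "v \<in> moderate I p" "(\<lambda>\<epsilon>. u \<epsilon> - v \<epsilon>) \<in> negligible I p"
  shows "colombeau_class I p u = colombeau_class I p v"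
  using assms equiv_class_eq[OF equiv_colombeau_rel]
  by (simp add: colombeau_class_def colombeau_rel_def)

lemma colombeau_class_self: "u \<in> moderate I p \<Longrightarrow> u \<in> colombeau_class I p u"
  using negligible_zero by (simp add: colombeau_class_def colombeau_rel_def)

lemma colombeau_classD:
  assumes "v \<in> colombeau_class I p u"
  shows "u \<in> moderate I p" "v \<in> moderate I p" "(\<lambda>\<epsilon>. v \<epsilon> - u \<epsilon>) \<in> negligible I p"
  using assms negligible_minus[of "\<lambda>\<epsilon>. u \<epsilon> - v \<epsilon>"]
  by (auto simp: colombeau_class_def colombeau_rel_def)

lemma colombeau_add_class:
  assumes "u \<in> moderate I p" "v \<in> moderate I p"
  shows "colombeau_add I p (colombeau_class I p u) (colombeau_class I p v) =
         colombeau_class I p (\<lambda>\<epsilon>. u \<epsilon> + v \<epsilon>)"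
proof -
  have "colombeau_class I p (\<lambda>\<epsilon>. u' \<epsilon> + v' \<epsilon>) = colombeau_class I p (\<lambda>\<epsilon>. u \<epsilon> + v \<epsilon>)"
    if "u' \<in> colombeau_class I p u" "v' \<in> colombeau_class I p v" for u' v'
    using colombeau_classD[OF that(1)] colombeau_classD[OF that(2)] sn
      negligible_add[of I p "\<lambda>\<epsilon>. u' \<epsilon> - u \<epsilon>" "\<lambda>\<epsilon>. v' \<epsilon> - v \<epsilon>"]
    by (intro colombeau_class_eq moderate_add) (auto simp: algebra_simps)
  then show ?thesis
    unfolding colombeau_add_def
    using colombeau_class_self[OF assms(1)] colombeau_class_self[OF assms(2)] by blast
qed

end

context
  fixes I :: "'i set" and p :: "'i \<Rightarrow> 'a::real_vector \<Rightarrow> real"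
  assumes sn: "\<And>i. i \<in> I \<Longrightarrow> seminorm (p i)"
begin

lemma colombeau_scale_class:
  assumes "c \<in> moderate UNIV real_seminorms" "u \<in> moderate I p"
  shows "colombeau_scale I p (colombeau_class UNIV real_seminorms c) (colombeau_class I p u) =
         colombeau_class I p (\<lambda>\<epsilon>. c \<epsilon> *\<^sub>R u \<epsilon>)"
proof -
  have "colombeau_class I p (\<lambda>\<epsilon>. c' \<epsilon> *\<^sub>R u' \<epsilon>) = colombeau_class I p (\<lambda>\<epsilon>. c \<epsilon> *\<^sub>R u \<epsilon>)"
    if c': "c' \<in> colombeau_class UNIV real_seminorms c" and u': "u' \<in> colombeau_class I p u" for c' u'
  proof (rule colombeau_class_eq[OF sn])
    note C = colombeau_classD[OF seminorm_real c'] and U = colombeau_classD[OF sn u']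
    show "(\<lambda>\<epsilon>. c' \<epsilon> *\<^sub>R u' \<epsilon>) \<in> moderate I p" "(\<lambda>\<epsilon>. c \<epsilon> *\<^sub>R u \<epsilon>) \<in> moderate I p"
      using C U by (auto intro!: moderate_scale sn)
    have "(\<lambda>\<epsilon>. (c' \<epsilon> - c \<epsilon>) *\<^sub>R u' \<epsilon> + c \<epsilon> *\<^sub>R (u' \<epsilon> - u \<epsilon>)) \<in> negligible I p"
      using C U by (intro negligible_add negligible_scale_left negligible_scale_right sn) auto
    then show "(\<lambda>\<epsilon>. c' \<epsilon> *\<^sub>R u' \<epsilon> - c \<epsilon> *\<^sub>R u \<epsilon>) \<in> negligible I p"
      by (simp add: algebra_simps)
  qed
  then show ?thesis
    unfolding colombeau_scale_def
    using colombeau_class_self[OF seminorm_real assms(1)] colombeau_class_self[OF sn assms(2)]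
    by blast
qed

lemma abelian_group_colombeau: "abelian_group (colombeau I p)"
proof (rule abelian_groupI, unfold colombeau_def, simp_all)
  show "colombeau_class I p (\<lambda>_. 0) \<in> colombeau_carrier I p"
    by (intro colombeau_class_in_carrier sn moderate_zero)
next
  fix X Y assume X: "X \<in> colombeau_carrier I p" and Y: "Y \<in> colombeau_carrier I p"
  obtain u v where u: "u \<in> moderate I p" "X = colombeau_class I p u"
    and v: "v \<in> moderate I p" "Y = colombeau_class I p v"
    using colombeau_carrier_cases[OF sn X] colombeau_carrier_cases[OF sn Y] by metis
  show "colombeau_add I p X Y \<in> colombeau_carrier I p"
    using u v by (simp add: colombeau_add_class sn colombeau_class_in_carrier moderate_add)
  show "colombeau_add I p X Y = colombeau_add I p Y X"
    using u v by (simp add: colombeau_add_class sn add.commute)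
next
  fix X Y Z assume X: "X \<in> colombeau_carrier I p" and Y: "Y \<in> colombeau_carrier I p"
    and Z: "Z \<in> colombeau_carrier I p"
  obtain u v w where "u \<in> moderate I p" "X = colombeau_class I p u"
    "v \<in> moderate I p" "Y = colombeau_class I p v" "w \<in> moderate I p" "Z = colombeau_class I p w"
    using colombeau_carrier_cases[OF sn X] colombeau_carrier_cases[OF sn Y]
      colombeau_carrier_cases[OF sn Z] by metis
  then show "colombeau_add I p (colombeau_add I p X Y) Z =
      colombeau_add I p X (colombeau_add I p Y Z)"
    by (simp add: colombeau_add_class sn moderate_add add.assoc)
next
  fix X assume X: "X \<in> colombeau_carrier I p"
  obtain u where u: "u \<in> moderate I p" "X = colombeau_class I p u"
    using colombeau_carrier_cases[OF sn X] by metis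
  show "colombeau_add I p (colombeau_class I p (\<lambda>_. 0)) X = X"
    using u by (simp add: colombeau_add_class sn moderate_zero)
  show "\<exists>Y\<in>colombeau_carrier I p. colombeau_add I p Y X = colombeau_class I p (\<lambda>_. 0)"
    using u by (intro bexI[of _ "colombeau_class I p (\<lambda>\<epsilon>. - u \<epsilon>)"])
      (auto simp: colombeau_add_class sn moderate_minus intro!: colombeau_class_in_carrier)
qed

end

lemma gen_real_mult_scale: "mult gen_real = colombeau_scale UNIV real_seminorms"
  by (simp add: gen_real_def colombeau_scale_def fun_eq_iff)

lemma gen_real_ex:
  assumes "X \<in> carrier gen_real"
  shows "\<exists>u. u \<in> moderate UNIV real_seminorms \<and> X = colombeau_class UNIV real_seminorms u"
  using assms colombeau_carrier_ex[OF seminorm_real, of X UNIV] by (simp add: gen_real_def)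

lemma cring_gen_real: "cring gen_real"
proof (rule cringI)
  let ?G = "colombeau UNIV real_seminorms"
  interpret G: abelian_group ?G by (intro abelian_group_colombeau seminorm_real)
  have eqs: "carrier gen_real = carrier ?G" "add gen_real = add ?G" "zero gen_real = zero ?G"
    by (simp_all add: gen_real_def colombeau_def)
  show "abelian_group gen_real"
  proof (rule abelian_groupI, unfold eqs)
    fix X assume X: "X \<in> carrier ?G"
    show "\<exists>Y\<in>carrier ?G. Y \<oplus>\<^bsub>?G\<^esub> X = \<zero>\<^bsub>?G\<^esub>"
      using G.l_neg[OF X] G.a_inv_closed[OF X] by blast
  qed (simp_all add: G.a_ac)
  note simps = gen_real_mult_scale colombeau_scale_class[OF seminorm_real]
    colombeau_add_class[OF seminorm_real] moderate_add[OF seminorm_real]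
    moderate_scale[OF seminorm_real, simplified] colombeau_class_in_carrier[OF seminorm_real]
    moderate_real_const
  have fields: "carrier gen_real = colombeau_carrier UNIV real_seminorms"
    "one gen_real = colombeau_class UNIV real_seminorms (\<lambda>_. 1)"
    "add gen_real = colombeau_add UNIV real_seminorms"
    by (simp_all add: gen_real_def)
  show "comm_monoid gen_real"
  proof (rule comm_monoidI, unfold fields)
    fix X Y Z assume X: "X \<in> colombeau_carrier UNIV real_seminorms"
      and Y: "Y \<in> colombeau_carrier UNIV real_seminorms"
      and Z: "Z \<in> colombeau_carrier UNIV real_seminorms"
    obtain u v w where "u \<in> moderate UNIV real_seminorms" "X = colombeau_class UNIV real_seminorms u"
      "v \<in> moderate UNIV real_seminorms" "Y = colombeau_class UNIV real_seminorms v"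
      "w \<in> moderate UNIV real_seminorms" "Z = colombeau_class UNIV real_seminorms w"
      using colombeau_carrier_cases[OF seminorm_real X] colombeau_carrier_cases[OF seminorm_real Y]
        colombeau_carrier_cases[OF seminorm_real Z] by metis
    then show "X \<otimes>\<^bsub>gen_real\<^esub> Y \<otimes>\<^bsub>gen_real\<^esub> Z = X \<otimes>\<^bsub>gen_real\<^esub> (Y \<otimes>\<^bsub>gen_real\<^esub> Z)"
      by (simp add: simps mult.assoc)
  next
    fix X Y assume X: "X \<in> colombeau_carrier UNIV real_seminorms"
      and Y: "Y \<in> colombeau_carrier UNIV real_seminorms"
    obtain u v where uv: "u \<in> moderate UNIV real_seminorms" "X = colombeau_class UNIV real_seminorms u"
      "v \<in> moderate UNIV real_seminorms" "Y = colombeau_class UNIV real_seminorms v"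
      using colombeau_carrier_cases[OF seminorm_real X] colombeau_carrier_cases[OF seminorm_real Y]
      by metis
    then show "X \<otimes>\<^bsub>gen_real\<^esub> Y \<in> colombeau_carrier UNIV real_seminorms"
      by (simp add: simps)
    from uv show "X \<otimes>\<^bsub>gen_real\<^esub> Y = Y \<otimes>\<^bsub>gen_real\<^esub> X"
      by (simp add: simps mult.commute)
  next
    fix X assume X: "X \<in> colombeau_carrier UNIV real_seminorms"
    obtain u where "u \<in> moderate UNIV real_seminorms" "X = colombeau_class UNIV real_seminorms u"
      using colombeau_carrier_cases[OF seminorm_real X] by metis
    then show "colombeau_class UNIV real_seminorms (\<lambda>_. 1) \<otimes>\<^bsub>gen_real\<^esub> X = X"
      by (simp add: simps)
  qed (simp add: simps)
  fix X Y Z assume "X \<in> carrier gen_real" "Y \<in> carrier gen_real" "Z \<in> carrier gen_real"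
  then obtain u v w where "u \<in> moderate UNIV real_seminorms" "X = colombeau_class UNIV real_seminorms u"
    "v \<in> moderate UNIV real_seminorms" "Y = colombeau_class UNIV real_seminorms v"
    "w \<in> moderate UNIV real_seminorms" "Z = colombeau_class UNIV real_seminorms w"
    using gen_real_ex by metis
  then show "(X \<oplus>\<^bsub>gen_real\<^esub> Y) \<otimes>\<^bsub>gen_real\<^esub> Z = X \<otimes>\<^bsub>gen_real\<^esub> Z \<oplus>\<^bsub>gen_real\<^esub> Y \<otimes>\<^bsub>gen_real\<^esub> Z"
    by (simp add: simps fields distrib_right)
qed

theorem module_colombeau:
  fixes I :: "'i set" and p :: "'i \<Rightarrow> 'a::real_vector \<Rightarrow> real"
  assumes sn: "\<And>i. i \<in> I \<Longrightarrow> seminorm (p i)"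
  shows "module gen_real (colombeau I p)"
proof (rule moduleI)
  show "cring gen_real" by (rule cring_gen_real)
  show "abelian_group (colombeau I p)" by (rule abelian_group_colombeau) (rule sn)
  note simps = gen_real_mult_scale colombeau_scale_class[OF sn] colombeau_add_class[OF sn]
    moderate_add[OF sn] moderate_scale[OF sn] colombeau_class_in_carrier[OF sn]
    colombeau_scale_class[OF seminorm_real]
    colombeau_add_class[OF seminorm_real] moderate_add[OF seminorm_real]
    moderate_scale[OF seminorm_real, simplified] moderate_real_const
  have fields: "carrier gen_real = colombeau_carrier UNIV real_seminorms"
    "one gen_real = colombeau_class UNIV real_seminorms (\<lambda>_. 1)"
    "add gen_real = colombeau_add UNIV real_seminorms"
    "carrier (colombeau I p) = colombeau_carrier I p"
    "add (colombeau I p) = colombeau_add I p"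
    "smult (colombeau I p) = colombeau_scale I p"
    by (simp_all add: gen_real_def colombeau_def)
  have colombeau_ex: "\<exists>u. u \<in> moderate I p \<and> X = colombeau_class I p u"
    if "X \<in> carrier (colombeau I p)" for X
    using colombeau_carrier_ex[of I p X] sn that unfolding fields by blast
  fix C D X Y
  show "\<one>\<^bsub>gen_real\<^esub> \<odot>\<^bsub>colombeau I p\<^esub> X = X" if XY: "X \<in> carrier (colombeau I p)"
  proof -
    obtain v where "v \<in> moderate I p" "X = colombeau_class I p v"
      using colombeau_ex XY by metis
    then show ?thesis by (simp add: fields simps)
  qed
  assume "C \<in> carrier gen_real"
  then obtain c where c: "c \<in> moderate UNIV real_seminorms" "C = colombeau_class UNIV real_seminorms c"
    using gen_real_ex by metis
  show "C \<odot>\<^bsub>colombeau I p\<^esub> X \<in> carrier (colombeau I p)" if XY: "X \<in> carrier (colombeau I p)"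
  proof -
    obtain v where "v \<in> moderate I p" "X = colombeau_class I p v"
      using colombeau_ex XY by metis
    then show ?thesis using c by (simp add: fields simps)
  qed
  show "C \<odot>\<^bsub>colombeau I p\<^esub> (X \<oplus>\<^bsub>colombeau I p\<^esub> Y) =
      C \<odot>\<^bsub>colombeau I p\<^esub> X \<oplus>\<^bsub>colombeau I p\<^esub> C \<odot>\<^bsub>colombeau I p\<^esub> Y"
    if XY: "X \<in> carrier (colombeau I p)" "Y \<in> carrier (colombeau I p)"
  proof -
    obtain v w where "v \<in> moderate I p" "X = colombeau_class I p v"
      "w \<in> moderate I p" "Y = colombeau_class I p w"
      using colombeau_ex XY by metis
    then show ?thesis using c by (simp add: fields simps scaleR_add_right)
  qed
  assume "D \<in> carrier gen_real"
  then obtain d where d: "d \<in> moderate UNIV real_seminorms" "D = colombeau_class UNIV real_seminorms d"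
    using gen_real_ex by metis
  assume "X \<in> carrier (colombeau I p)"
  then obtain u where u: "u \<in> moderate I p" "X = colombeau_class I p u"
    using colombeau_ex by metis
  show "(C \<oplus>\<^bsub>gen_real\<^esub> D) \<odot>\<^bsub>colombeau I p\<^esub> X =
      C \<odot>\<^bsub>colombeau I p\<^esub> X \<oplus>\<^bsub>colombeau I p\<^esub> D \<odot>\<^bsub>colombeau I p\<^esub> X"
    using c d u by (simp add: fields simps scaleR_add_left)
  show "(C \<otimes>\<^bsub>gen_real\<^esub> D) \<odot>\<^bsub>colombeau I p\<^esub> X =
      C \<odot>\<^bsub>colombeau I p\<^esub> (D \<odot>\<^bsub>colombeau I p\<^esub> X)"
    using c d u by (simp add: fields simps)
qed

end

theory Submission
  imports Defs
begin

text \<open>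
  The sum \<open>\<Sum>\<^sub>j e\<^bsub>S\<^sub>j\<^esub> a\<^sub>j\<close> is the class of the net \<open>\<Sum>\<^sub>j \<chi>\<^bsub>S\<^sub>j\<^esub>(\<epsilon>) u\<^sub>j(\<epsilon>)\<close>, for any
  representatives \<open>u\<^sub>j\<close> of the \<open>a\<^sub>j\<close> (\<open>finsum_gen_indicator_class\<close>). When the \<open>S\<^sub>j\<close> partition the
  unit interval, this net takes at each \<open>\<epsilon>\<close> the value of one of the \<open>u\<^sub>j\<close>. Belonging to an internal
  set \<open>[(A\<^sub>\<epsilon>)]\<close> is a condition on the separate values of a suitable representative: if every \<open>u\<^sub>j\<close> satisfies
  \<open>u\<^sub>j(\<epsilon>) \<in> A\<^sub>\<epsilon>\<close> for small \<open>\<epsilon>\<close>, then, there being finitely many \<open>j\<close>, so does the interleaved net.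
  This is \<open>internal_finite_interleaving\<close>. The pair \<open>S\<close>, \<open>S\<^sup>c\<close>, indexed by the Booleans, gives
  the first claim, and arbitrary finite partitions give the inclusion of the interleaved set in
  \<open>A\<close>. The reverse inclusion comes from the partition with one block, because
  the idempotent of the whole interval is \<open>1\<close>.
\<close>

lemma moderate_sum:
  assumes "\<And>i. i \<in> I \<Longrightarrow> seminorm (p i)" and "\<And>j. j \<in> J \<Longrightarrow> u j \<in> moderate I p"
  shows "(\<lambda>\<epsilon>. \<Sum>j\<in>J. u j \<epsilon>) \<in> moderate I p"
  using assms(2)
  by (induction J rule: infinite_finite_induct)
    (simp_all add: moderate_zero[OF assms(1)] moderate_add[OF assms(1)])

lemma gen_indicator_closed: "gen_indicator S \<in> carrier gen_real"
  using colombeau_class_in_carrier[OF seminorm_real moderate_indicator]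
  by (simp add: gen_indicator_def gen_real_def)

lemma gen_indicator_scale_class:
  assumes "\<And>i. i \<in> I \<Longrightarrow> seminorm (p i)" and "u \<in> moderate I p"
  shows "gen_indicator S \<odot>\<^bsub>colombeau I p\<^esub> colombeau_class I p u =
         colombeau_class I p (\<lambda>\<epsilon>. indicator S \<epsilon> *\<^sub>R u \<epsilon>)"
  using colombeau_scale_class[OF assms(1) moderate_indicator assms(2)]
  by (simp add: gen_indicator_def colombeau_def)

lemma finsum_gen_indicator_class:
  assumes sn: "\<And>i. i \<in> I \<Longrightarrow> seminorm (p i)"
    and "finite J" and "\<And>j. j \<in> J \<Longrightarrow> u j \<in> moderate I p"
  shows "(\<Oplus>\<^bsub>colombeau I p\<^esub>j\<in>J. gen_indicator (S j) \<odot>\<^bsub>colombeau I p\<^esub> colombeau_class I p (u j)) =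
         colombeau_class I p (\<lambda>\<epsilon>. \<Sum>j\<in>J. indicator (S j) \<epsilon> *\<^sub>R u j \<epsilon>)"
  using assms(2,3)
proof (induction J)
  case empty
  interpret module gen_real "colombeau I p" by (rule module_colombeau) (rule sn)
  show ?case by simp (simp add: colombeau_def)
next
  case (insert k J)
  interpret module gen_real "colombeau I p" by (rule module_colombeau) (rule sn)
  let ?a = "\<lambda>j. gen_indicator (S j) \<odot>\<^bsub>colombeau I p\<^esub> colombeau_class I p (u j)"
  let ?w = "\<lambda>j \<epsilon>. indicator (S j) \<epsilon> *\<^sub>R u j \<epsilon>"
  have w: "?w j \<in> moderate I p" if "j \<in> insert k J" for j
    by (rule moderate_scale[OF sn moderate_indicator insert.prems[OF that]])
  have a: "?a j \<in> carrier (colombeau I p)" if "j \<in> insert k J" for j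
    using colombeau_class_in_carrier[OF sn insert.prems[OF that]]
    by (intro smult_closed gen_indicator_closed) (simp add: colombeau_def)
  have "finsum (colombeau I p) ?a (insert k J) = ?a k \<oplus>\<^bsub>colombeau I p\<^esub> finsum (colombeau I p) ?a J"
    using insert.hyps a by (intro finsum_insert Pi_I) auto
  also have "finsum (colombeau I p) ?a J = colombeau_class I p (\<lambda>\<epsilon>. \<Sum>j\<in>J. ?w j \<epsilon>)"
    using insert by blast
  also have "?a k = colombeau_class I p (?w k)"
    using insert.prems by (intro gen_indicator_scale_class[OF sn]) auto
  also have "colombeau_class I p (?w k) \<oplus>\<^bsub>colombeau I p\<^esub> colombeau_class I p (\<lambda>\<epsilon>. \<Sum>j\<in>J. ?w j \<epsilon>) =
      colombeau_class I p (\<lambda>\<epsilon>. ?w k \<epsilon> + (\<Sum>j\<in>J. ?w j \<epsilon>))"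
  proof -
    have "(\<lambda>\<epsilon>. \<Sum>j\<in>J. ?w j \<epsilon>) \<in> moderate I p"
      by (intro moderate_sum sn w) auto
    then show ?thesis
      using colombeau_add_class[OF sn w[of k]] by (simp add: colombeau_def)
  qed
  finally show ?case by (simp only: sum.insert[OF insert.hyps])
qed

lemma internal_set_iff_eventually:
  "U \<in> internal_set I p A \<longleftrightarrow>
     U \<in> colombeau_carrier I p \<and> (\<exists>u\<in>U. \<forall>\<^sub>F \<epsilon> in at_right 0. u \<epsilon> \<in> A \<epsilon>)"
proof -
  have "(\<exists>\<eta>>0. \<forall>\<epsilon>\<in>{0<..<1}. \<epsilon> < \<eta> \<longrightarrow> P \<epsilon>) \<longleftrightarrow> (\<forall>\<^sub>F \<epsilon> in at_right (0::real). P \<epsilon>)" for P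
  proof
    assume "\<exists>\<eta>>0. \<forall>\<epsilon>\<in>{0<..<1}. \<epsilon> < \<eta> \<longrightarrow> P \<epsilon>"
    then obtain \<eta> where "\<eta> > 0" "\<forall>\<epsilon>\<in>{0<..<1}. \<epsilon> < \<eta> \<longrightarrow> P \<epsilon>" by blast
    then show "\<forall>\<^sub>F \<epsilon> in at_right 0. P \<epsilon>"
      by (auto simp: eventually_at_right_field intro!: exI[of _ "min \<eta> 1"])
  qed (auto simp: eventually_at_right_field)
  then show ?thesis by (simp add: internal_set_def colombeau_def)
qed

text \<open>
  Disjointness and covering leave exactly one summand at each \<open>\<epsilon>\<close>, so the net that represents the sum takes
  there the value of one of the given representatives; finiteness of \<open>J\<close> gives an \<open>\<eta>\<close> that serves
  all of them. A disjoint family may have empty members, unlike a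
  partition, so this covers a set and its complement even when one of the two is empty.
\<close>

lemma internal_finite_interleaving:
  assumes sn: "\<And>i. i \<in> I \<Longrightarrow> seminorm (p i)"
    and "internal I p B" and "finite J" and disj: "disjoint_family_on S J"
    and cover: "{0<..<1} \<subseteq> (\<Union>j\<in>J. S j)" and aB: "\<And>j. j \<in> J \<Longrightarrow> a j \<in> B"
  shows "(\<Oplus>\<^bsub>colombeau I p\<^esub>j\<in>J. gen_indicator (S j) \<odot>\<^bsub>colombeau I p\<^esub> a j) \<in> B"
proof -
  obtain A where B: "B = internal_set I p A"
    using \<open>internal I p B\<close> by (auto simp: internal_def)
  have "\<exists>u. u \<in> moderate I p \<and> a j = colombeau_class I p u \<and> (\<forall>\<^sub>F \<epsilon> in at_right 0. u \<epsilon> \<in> A \<epsilon>)"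
    if j: "j \<in> J" for j
  proof -
    obtain u where u: "u \<in> a j" "\<forall>\<^sub>F \<epsilon> in at_right 0. u \<epsilon> \<in> A \<epsilon>" and "a j \<in> colombeau_carrier I p"
      using aB[OF j] unfolding B internal_set_iff_eventually by blast
    then obtain v where v: "v \<in> moderate I p" "a j = colombeau_class I p v"
      using colombeau_carrier_ex[of I p "a j"] sn by blast
    then have "u \<in> colombeau_class I p v" using u by simp
    \<comment> \<open>The representative that meets \<open>A\<close> need not be the given \<open>v\<close>, but it defines the same class.\<close>
    then have u': "u \<in> moderate I p" "(\<lambda>\<epsilon>. u \<epsilon> - v \<epsilon>) \<in> negligible I p"
      using colombeau_classD[of I p u v] sn by blast+
    have "colombeau_class I p u = colombeau_class I p v"
      by (intro colombeau_class_eq sn u' v(1))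
    then have "a j = colombeau_class I p u" by (simp add: v(2))
    with u' u(2) show ?thesis by (intro exI[of _ u] conjI)
  qed
  then obtain u where u: "\<And>j. j \<in> J \<Longrightarrow> u j \<in> moderate I p"
      "\<And>j. j \<in> J \<Longrightarrow> a j = colombeau_class I p (u j)"
      "\<And>j. j \<in> J \<Longrightarrow> \<forall>\<^sub>F \<epsilon> in at_right 0. u j \<epsilon> \<in> A \<epsilon>"
    by metis
  let ?w = "\<lambda>\<epsilon>. \<Sum>j\<in>J. indicator (S j) \<epsilon> *\<^sub>R u j \<epsilon>"
  have w: "?w \<in> moderate I p"
    by (intro moderate_sum moderate_scale moderate_indicator sn u(1))
  interpret module gen_real "colombeau I p" by (rule module_colombeau) (rule sn)
  have "(\<Oplus>\<^bsub>colombeau I p\<^esub>j\<in>J. gen_indicator (S j) \<odot>\<^bsub>colombeau I p\<^esub> a j) =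
      (\<Oplus>\<^bsub>colombeau I p\<^esub>j\<in>J. gen_indicator (S j) \<odot>\<^bsub>colombeau I p\<^esub> colombeau_class I p (u j))"
  proof (rule add.finprod_cong')
    show "(\<lambda>j. gen_indicator (S j) \<odot>\<^bsub>colombeau I p\<^esub> colombeau_class I p (u j)) \<in> J \<rightarrow> carrier (colombeau I p)"
    proof (intro Pi_I smult_closed gen_indicator_closed)
      fix j assume "j \<in> J"
      then have "colombeau_class I p (u j) \<in> colombeau_carrier I p"
        by (intro colombeau_class_in_carrier sn u(1))
      then show "colombeau_class I p (u j) \<in> carrier (colombeau I p)"
        by (simp add: colombeau_def)
    qed
  qed (use u(2) in auto)
  also have "\<dots> = colombeau_class I p ?w"
    by (rule finsum_gen_indicator_class[OF sn \<open>finite J\<close> u(1)])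
  also have "\<dots> \<in> B"
    unfolding B internal_set_iff_eventually
  proof (intro conjI bexI)
    show "colombeau_class I p ?w \<in> colombeau_carrier I p"
      by (intro colombeau_class_in_carrier sn w)
    show "?w \<in> colombeau_class I p ?w"
      by (intro colombeau_class_self sn w)
    have "\<forall>\<^sub>F \<epsilon> in at_right 0. \<forall>j\<in>J. u j \<epsilon> \<in> A \<epsilon>"
      using \<open>finite J\<close> u(3) by (intro eventually_ball_finite) auto
    then show "\<forall>\<^sub>F \<epsilon> in at_right 0. ?w \<epsilon> \<in> A \<epsilon>"
      using eventually_small
    proof eventually_elim
      case (elim \<epsilon>)
      then have "\<epsilon> \<in> {0<..<1}" by simp
      then have "\<epsilon> \<in> (\<Union>j\<in>J. S j)" using cover by blast
      then obtain k where k: "k \<in> J" "\<epsilon> \<in> S k" by blast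
      have "{j \<in> J. \<epsilon> \<in> S j} = {k}"
        using disj k by (auto simp: disjoint_family_on_def)
      then have "?w \<epsilon> = u k \<epsilon>"
        using \<open>finite J\<close> by simp
      then show ?case using elim k by simp
    qed
  qed
  finally show ?thesis .
qed

text \<open>
  The indicator differs from the constant \<open>1\<close> as a function on the reals, but
  not on the unit interval, and so not as a generalized number.
\<close>

lemma gen_indicator_unit_interval: "gen_indicator {0<..<1} = \<one>\<^bsub>gen_real\<^esub>"
proof -
  have "(\<lambda>\<epsilon>. indicator {0<..<1} \<epsilon> - (1::real)) \<in> negligible UNIV real_seminorms"
    unfolding negligible_iff
  proof (intro ballI allI)
    fix m :: nat
    show "\<forall>\<^sub>F \<epsilon> in at_right 0. \<bar>indicator {0<..<1} \<epsilon> - (1::real)\<bar> \<le> \<epsilon> ^ m"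
      by (rule eventually_mono[OF eventually_small]) auto
  qed
  then show ?thesis
    unfolding gen_indicator_def gen_real_def
    using colombeau_class_eq[OF seminorm_real moderate_indicator moderate_real_const] by simp
qed

lemma subset_interl:
  assumes sn: "\<And>i. i \<in> I \<Longrightarrow> seminorm (p i)" and "A \<subseteq> carrier (colombeau I p)"
  shows "A \<subseteq> interl I p A"
proof
  fix x assume "x \<in> A"
  interpret module gen_real "colombeau I p" by (rule module_colombeau) (rule sn)
  have "x \<in> carrier (colombeau I p)" using \<open>x \<in> A\<close> assms(2) by blast
  then have "x = (\<Oplus>\<^bsub>colombeau I p\<^esub>j\<in>{1..1::nat}. gen_indicator {0<..<1} \<odot>\<^bsub>colombeau I p\<^esub> x)"
    by (simp add: gen_indicator_unit_interval)
  moreover have "partition_on {0<..<1::real} ((\<lambda>_. {0<..<1}) ` {1..1::nat})"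
    by (auto intro!: partition_onI)
  ultimately show "x \<in> interl I p A"
    unfolding interl_def using \<open>x \<in> A\<close>
    by (intro CollectI exI[of _ "1::nat"] exI[of _ "\<lambda>_. {0<..<1}"] exI[of _ "\<lambda>_. x"]) auto
qed

theorem theorem3p6:
  fixes T :: "'a::real_vector topology" and I :: "'i set" and p :: "'i \<Rightarrow> 'a \<Rightarrow> real"
  assumes "locally_convex_space T I p"
  shows "(\<forall>A S. internal I p A \<and> S \<subseteq> {0<..<1} \<longrightarrow>
            (\<forall>u\<in>A. \<forall>v\<in>A.
               (gen_indicator S \<odot>\<^bsub>colombeau I p\<^esub> u) \<oplus>\<^bsub>colombeau I p\<^esub>
               (gen_indicator ({0<..<1} - S) \<odot>\<^bsub>colombeau I p\<^esub> v) \<in> A)) \<and>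
         (\<forall>A. A \<subseteq> carrier (colombeau I p) \<longrightarrow>
            A \<subseteq> interl I p A \<and> (internal I p A \<longrightarrow> interl I p A = A))"
proof (intro conjI allI impI ballI)
  have sn: "seminorm (p i)" if "i \<in> I" for i
    using assms that by (simp add: locally_convex_space_def)
  interpret module gen_real "colombeau I p" by (rule module_colombeau) (rule sn)
  {
    fix A u v and S :: "real set"
    assume A: "internal I p A \<and> S \<subseteq> {0<..<1}" and uv: "u \<in> A" "v \<in> A"
    have uv': "u \<in> carrier (colombeau I p)" "v \<in> carrier (colombeau I p)"
      using A uv by (auto simp: internal_def internal_set_def)
    let ?x = "\<lambda>b. gen_indicator (if b then S else {0<..<1} - S) \<odot>\<^bsub>colombeau I p\<^esub> (if b then u else v)"
    have x: "?x \<in> R \<rightarrow> carrier (colombeau I p)" for R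
      using uv' by (intro Pi_I smult_closed gen_indicator_closed) auto
    have "finsum (colombeau I p) ?x {True, False} \<in> A"
      using A uv by (intro internal_finite_interleaving[OF sn]) (auto simp: disjoint_family_on_def)
    moreover have "finsum (colombeau I p) ?x {True, False} = ?x True \<oplus>\<^bsub>colombeau I p\<^esub> ?x False"
      using finsum_insert[of "{False}" True ?x] finsum_insert[of "{}" False ?x] x uv' gen_indicator_closed
      by (simp del: finsum_insert)
    ultimately show "(gen_indicator S \<odot>\<^bsub>colombeau I p\<^esub> u) \<oplus>\<^bsub>colombeau I p\<^esub>
        (gen_indicator ({0<..<1} - S) \<odot>\<^bsub>colombeau I p\<^esub> v) \<in> A"
      by (simp only: if_True if_False)
  }
  fix A assume A: "A \<subseteq> carrier (colombeau I p)"
  show sub: "A \<subseteq> interl I p A" using subset_interl[OF sn A] .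
  assume int: "internal I p A"
  have "interl I p A \<subseteq> A"
  proof
    fix x assume "x \<in> interl I p A"
    then obtain m S a
      where x: "x = (\<Oplus>\<^bsub>colombeau I p\<^esub>j\<in>{1..m}. gen_indicator (S j) \<odot>\<^bsub>colombeau I p\<^esub> a j)"
        and part: "partition_on {0<..<1} (S ` {1..m::nat})" and inj: "inj_on S {1..m}"
        and a: "\<forall>j\<in>{1..m}. a j \<in> A"
      unfolding interl_def by blast
    have "disjoint_family_on S {1..m}"
      using partition_onD2[OF part] inj by (auto intro: disjoint_image_disjoint_family_on)
    then show "x \<in> A"
      unfolding x using partition_onD1[OF part] a
      by (intro internal_finite_interleaving[OF sn int]) auto
  qed
  with sub show "interl I p A = A" by blast
qed

end
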